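(* Let $m_1,m_2,\dots,m_t$ be positive integers with $m_1=\max\{m_i\}_{i=1}^t$, and let $G=K_{m_1,m_2,\dots,m_t}$ be the complete multipartite graph whose $i$-th part has $m_i$ vertices. Then: (1) any edge connecting two vertices in a part of order $m_1$ is forbidden for $G$; (2) any edge connecting two vertices in any part of order $m_i$ with $i\neq 1$ is good for $G$; (3) $\mu(K_{m_1,m_2,\dots,m_t})=\sum_{i=2}^{t}\dfrac{(m_i-1)m_i}{2}$.
   Context: A $k$-ranking of a graph $G$ is a labeling $f:V(G)\to\{1,\dots,k\}$ such that whenever $f(u)=f(v)$ for distinct $u,v$, every $u$–$v$ path contains a vertex $w$ with $f(w)>f(u)$; the rank number $\chi_r(G)$ is the smallest $k$ for which $G$ has a $k$-ranking. An edge $e$ on $V(G)$ not in $G$ is good for $G$ if $\chi_r(G\cup\{e\})=\chi_r(G)$ and forbidden if $\chi_r(G\cup\{e\})>\chi_r(G)$. $\mu(G)$ denotes the maximum cardinality of a set $H$ of edges on $V(G)$, not in $G$, such that $\chi_r(G\cup H)=\chi_r(G)$.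
   Formalization: Part (1) is proved assuming m_i ≠ m_1 for all i ≥ 2; with a tie for the maximum it is false: in K_{2,2} (rank number 3) adding an edge inside a part gives K_4 minus an edge, still of rank number 3. *)

theory Defs
  imports Complex_Main "HOL-Library.Disjoint_Sets"
begin

text \<open>A simple graph is given by its vertex set \<open>V\<close> and its set \<open>E\<close> of edges, an edge being a
  two-element subset of \<open>V\<close>.\<close>

definition all_edges :: "'a set \<Rightarrow> 'a set set" where
  "all_edges V = {{u, v} | u v. u \<in> V \<and> v \<in> V \<and> u \<noteq> v}"

definition non_edges :: "'a set \<Rightarrow> 'a set set \<Rightarrow> 'a set set" where
  "non_edges V E = all_edges V - E"

definition is_path :: "'a set \<Rightarrow> 'a set set \<Rightarrow> 'a \<Rightarrow> 'a list \<Rightarrow> 'a \<Rightarrow> bool" where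
  "is_path V E u p v \<longleftrightarrow>
     p \<noteq> [] \<and> hd p = u \<and> last p = v \<and> set p \<subseteq> V \<and> distinct p \<and>
     successively (\<lambda>x y. {x, y} \<in> E) p"

definition is_ranking :: "'a set \<Rightarrow> 'a set set \<Rightarrow> nat \<Rightarrow> ('a \<Rightarrow> nat) \<Rightarrow> bool" where
  "is_ranking V E k f \<longleftrightarrow>
     f ` V \<subseteq> {1..k} \<and>
     (\<forall>u\<in>V. \<forall>v\<in>V. u \<noteq> v \<and> f u = f v \<longrightarrow>
        (\<forall>p. is_path V E u p v \<longrightarrow> (\<exists>w\<in>set p. f w > f u)))"

text \<open>For finite \<open>V\<close> some ranking exists (label the vertices injectively), so the minimum is
  attained.\<close>

definition rank_number :: "'a set \<Rightarrow> 'a set set \<Rightarrow> nat" where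
  "rank_number V E = (LEAST k. \<exists>f. is_ranking V E k f)"

definition good_edge :: "'a set \<Rightarrow> 'a set set \<Rightarrow> 'a set \<Rightarrow> bool" where
  "good_edge V E e \<longleftrightarrow> e \<in> non_edges V E \<and> rank_number V (E \<union> {e}) = rank_number V E"

definition forbidden_edge :: "'a set \<Rightarrow> 'a set set \<Rightarrow> 'a set \<Rightarrow> bool" where
  "forbidden_edge V E e \<longleftrightarrow> e \<in> non_edges V E \<and> rank_number V (E \<union> {e}) > rank_number V E"

text \<open>For finite \<open>V\<close> the set below is finite, and it contains \<open>0\<close> because of \<open>H = {}\<close>.\<close>

definition mu :: "'a set \<Rightarrow> 'a set set \<Rightarrow> nat" where
  "mu V E = Max {card H | H. H \<subseteq> non_edges V E \<and> rank_number V (E \<union> H) = rank_number V E}"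

text \<open>The complete multipartite graph with parts \<open>P 1, \<dots>, P t\<close>; the parts are meant to be
  pairwise disjoint.\<close>

definition multipartite_verts :: "nat \<Rightarrow> (nat \<Rightarrow> 'a set) \<Rightarrow> 'a set" where
  "multipartite_verts t P = (\<Union>i\<in>{1..t}. P i)"

definition multipartite_edges :: "nat \<Rightarrow> (nat \<Rightarrow> 'a set) \<Rightarrow> 'a set set" where
  "multipartite_edges t P =
     {{u, v} | u v. \<exists>i\<in>{1..t}. \<exists>j\<in>{1..t}. i \<noteq> j \<and> u \<in> P i \<and> v \<in> P j}"

end

theory Submission
  imports Defs
begin

text \<open>Two vertices sharing a label in a ranking of a supergraph of the complete multipartite graph
  lie in one part, and every vertex outside that part, being a common neighbour, has a larger label.
  Hence all repetitions occur inside a single part \<open>P i\<close>, so at least \<open>|V| - |P i| + 1\<close> labels are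
  used, with equality only if the labelling is constant on \<open>P i\<close>, which makes \<open>P i\<close> independent.
  Conversely an independent part can receive the label 1 throughout, all other vertices receiving
  distinct larger labels. So the rank number stays \<open>|V| - m 1 + 1\<close> precisely when the added edges
  spare some part of maximum order.\<close>

section \<open>Counting two-element subsets\<close>

lemma all_edges_eq: "all_edges A = {B. B \<subseteq> A \<and> card B = 2}"
  unfolding all_edges_def by (auto simp: card_2_iff)

lemma finite_all_edges: "finite A \<Longrightarrow> finite (all_edges A)"
  by (simp add: all_edges_eq)

lemma card_all_edges: "finite A \<Longrightarrow> card (all_edges A) = card A choose 2"
  by (simp add: all_edges_eq n_subsets)

lemma disjoint_all_edges: "A \<inter> B = {} \<Longrightarrow> all_edges A \<inter> all_edges B = {}"
  by (auto simp: all_edges_def doubleton_eq_iff)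

lemma real_choose_two: "real (n choose 2) = (real n - 1) * real n / 2"
proof (cases n)
  case (Suc k)
  \<comment> \<open>Makes the truncating division in \<open>choose_two\<close> exact, so that
    \<open>real\<close> passes through it.\<close>
  have "even (k * Suc k)" by simp
  then show ?thesis using Suc by (simp add: choose_two real_of_nat_div field_simps)
qed simp

section \<open>Rankings of arbitrary graphs\<close>

lemma is_ranking_not_adjacent:
  assumes "is_ranking V F k f" "u \<in> V" "v \<in> V" "u \<noteq> v" "f u = f v"
  shows "{u, v} \<notin> F"
proof
  assume "{u, v} \<in> F"
  \<comment> \<open>This path has no inner vertex that could carry a larger label.\<close>
  then have "is_path V F u [u, v] v"
    using assms by (simp add: is_path_def)
  then have "\<exists>w\<in>set [u, v]. f w > f u"
    using assms unfolding is_ranking_def by blast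
  then show False using assms by simp
qed

text \<open>On the path \<open>[u, w, v]\<close> only \<open>w\<close> can exceed the label shared
  by the ends.\<close>

lemma is_ranking_common_neighbour:
  assumes "is_ranking V F k f" "u \<in> V" "v \<in> V" "w \<in> V" "u \<noteq> v" "f u = f v"
    and "{u, w} \<in> F" "{w, v} \<in> F"
  shows "f u < f w"
proof (cases "w = u \<or> w = v")
  \<comment> \<open>If \<open>w\<close> is an end, one of the two assumed edges is
    \<open>{u, v}\<close> itself, which a repeated label excludes.\<close>
  case True
  then show ?thesis using is_ranking_not_adjacent[OF assms(1-3,5,6)] assms(7,8) by auto
next
  case False
  then have "is_path V F u [u, w, v] v"
    using assms by (auto simp: is_path_def)
  then have "\<exists>x\<in>set [u, w, v]. f x > f u"
    using assms unfolding is_ranking_def by blast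
  then show ?thesis using assms by simp
qed

lemma rank_number_le: "is_ranking V F k f \<Longrightarrow> rank_number V F \<le> k"
  unfolding rank_number_def by (rule Least_le) blast

text \<open>\<open>LEAST\<close> is meaningful only once some witness exists; hence the premise with
  an arbitrary \<open>k\<close>.\<close>

lemma rank_number_attained:
  assumes "is_ranking V F k f"
  obtains g where "is_ranking V F (rank_number V F) g"
  using LeastI[of "\<lambda>k. \<exists>f. is_ranking V F k f" k] assms unfolding rank_number_def by blast

lemma is_ranking_inj:
  assumes "inj_on f V" "f ` V \<subseteq> {1..k}"
  shows "is_ranking V F k f"
  using assms by (auto simp: is_ranking_def inj_on_def)

lemma ex_is_ranking:
  assumes "finite V"
  obtains k f where "is_ranking V F k f"
proof -
  obtain g where g: "bij_betw g V {0..<card V}"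
    using ex_bij_betw_finite_nat[OF assms] by blast
  then have "g x < card V" if "x \<in> V" for x using that by (auto simp: bij_betw_def)
  \<comment> \<open>Labels start at 1, whereas \<open>g\<close> starts at 0.\<close>
  then have "(\<lambda>x. Suc (g x)) ` V \<subseteq> {1..card V}" by (auto simp: Suc_le_eq)
  moreover have "inj_on (\<lambda>x. Suc (g x)) V" using g by (simp add: bij_betw_def inj_on_def)
  ultimately show ?thesis by (intro that is_ranking_inj)
qed

text \<open>All of \<open>A\<close> can share label 1, because a path between distinct vertices of
  an independent set leaves that set at its second vertex.\<close>

lemma rank_number_le_independent:
  assumes "finite V" "A \<subseteq> V" "\<And>u v. u \<in> A \<Longrightarrow> v \<in> A \<Longrightarrow> u \<noteq> v \<Longrightarrow> {u, v} \<notin> F"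
  shows "rank_number V F \<le> card V - card A + 1"
proof -
  obtain g where g: "bij_betw g (V - A) {0..<card (V - A)}"
    using ex_bij_betw_finite_nat[of "V - A"] assms by blast
  \<comment> \<open>The values of \<open>g\<close> lie below \<open>card V - card A\<close>, so the
    shift by 2 reserves 1 for \<open>A\<close> and keeps the other labels between 2 and
    \<open>card V - card A + 1\<close>.\<close>
  define f where "f x = (if x \<in> A then 1 else g x + 2)" for x
  have c: "card (V - A) = card V - card A"
    using assms by (simp add: card_Diff_subset finite_subset)
  have "is_ranking V F (card V - card A + 1) f"
    unfolding is_ranking_def
  proof (intro conjI ballI impI allI)
    have "g x < card V - card A" if "x \<in> V - A" for x
      using g that c by (auto simp: bij_betw_def)
    then show "f ` V \<subseteq> {1..card V - card A + 1}"
      by (force simp: f_def)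
  next
    fix u v p
    assume u: "u \<in> V" and v: "v \<in> V" and uv: "u \<noteq> v \<and> f u = f v" and p: "is_path V F u p v"
    \<comment> \<open>Outside \<open>A\<close> the labelling is injective and never 1, so a repeated
      label must be 1.\<close>
    have A: "u \<in> A" "v \<in> A"
      using u v uv g by (auto simp: f_def bij_betw_def inj_on_def split: if_splits)
    obtain w q where q: "p = u # w # q"
      using p uv by (cases p; cases "tl p") (auto simp: is_path_def)
    have "{u, w} \<in> F" "w \<noteq> u" using p q by (auto simp: is_path_def)
    then have "w \<notin> A" using assms(3) A by blast
    then show "\<exists>w\<in>set p. f u < f w" using A q by (auto simp: f_def)
  qed
  then show ?thesis by (rule rank_number_le)
qed

section \<open>Structure of the complete multipartite graph\<close>

locale multipartite =
  fixes t :: nat and P :: "nat \<Rightarrow> 'a set"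
  assumes t_pos: "t \<ge> 1"
    and disj: "disjoint_family_on P {1..t}"
    and fin: "i \<in> {1..t} \<Longrightarrow> finite (P i)"
    and nonempty: "i \<in> {1..t} \<Longrightarrow> P i \<noteq> {}"
    and card_le: "i \<in> {1..t} \<Longrightarrow> card (P i) \<le> card (P 1)"
begin

abbreviation V :: "'a set" where "V \<equiv> multipartite_verts t P"
abbreviation E :: "'a set set" where "E \<equiv> multipartite_edges t P"

lemma finite_V: "finite V"
  using fin by (simp add: multipartite_verts_def)

lemma part_subset: "i \<in> {1..t} \<Longrightarrow> P i \<subseteq> V"
  by (auto simp: multipartite_verts_def)

lemma part_unique: "i \<in> {1..t} \<Longrightarrow> j \<in> {1..t} \<Longrightarrow> x \<in> P i \<Longrightarrow> x \<in> P j \<Longrightarrow> i = j"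
  using disj unfolding disjoint_family_on_def by blast

lemma edge_iff:
  assumes "i \<in> {1..t}" "j \<in> {1..t}" "u \<in> P i" "v \<in> P j"
  shows "{u, v} \<in> E \<longleftrightarrow> i \<noteq> j"
proof
  assume "{u, v} \<in> E"
  then obtain x y a b where "{u, v} = {x, y}" "a \<in> {1..t}" "b \<in> {1..t}" "a \<noteq> b" "x \<in> P a" "y \<in> P b"
    unfolding multipartite_edges_def by blast
  then show "i \<noteq> j" using assms part_unique by (metis doubleton_eq_iff)
next
  assume "i \<noteq> j"
  then show "{u, v} \<in> E" using assms unfolding multipartite_edges_def by blast
qed

lemma edge_outside:
  assumes "i \<in> {1..t}" "u \<in> P i" "w \<in> V - P i"
  shows "{u, w} \<in> E" "{w, u} \<in> E"
proof -
  obtain j where "j \<in> {1..t}" "w \<in> P j" using assms by (auto simp: multipartite_verts_def)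
  then show "{u, w} \<in> E" "{w, u} \<in> E" using assms edge_iff by auto
qed

lemma non_edges_eq: "non_edges V E = (\<Union>i\<in>{1..t}. all_edges (P i))"
proof (intro equalityI subsetI)
  fix e assume e: "e \<in> non_edges V E"
  then obtain u v where uv: "e = {u, v}" "u \<in> V" "v \<in> V" "u \<noteq> v" "e \<notin> E"
    by (auto simp: non_edges_def all_edges_def)
  then obtain i where i: "i \<in> {1..t}" "u \<in> P i" by (auto simp: multipartite_verts_def)
  moreover have "v \<in> P i" using edge_outside(1)[OF i, of v] uv by auto
  ultimately have "e \<in> all_edges (P i)"
    using uv unfolding all_edges_def by blast
  then show "e \<in> (\<Union>i\<in>{1..t}. all_edges (P i))" using i by blast
next
  fix e assume "e \<in> (\<Union>i\<in>{1..t}. all_edges (P i))"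
  then obtain i u v where i: "i \<in> {1..t}" "u \<in> P i" "v \<in> P i" "u \<noteq> v" "e = {u, v}"
    by (auto simp: all_edges_def)
  then have "{u, v} \<notin> E" using edge_iff by blast
  then show "e \<in> non_edges V E"
    using i part_subset by (auto simp: non_edges_def all_edges_def)
qed

section \<open>How labels repeat, and the resulting rank number\<close>

lemma repeated_labels_in_one_part:
  assumes r: "is_ranking V F k f" and F: "E \<subseteq> F"
  obtains i where "i \<in> {1..t}" "\<And>u v. u \<in> V \<Longrightarrow> v \<in> V \<Longrightarrow> u \<noteq> v \<Longrightarrow> f u = f v \<Longrightarrow> u \<in> P i \<and> v \<in> P i"
proof (cases "inj_on f V")
  case True
  \<comment> \<open>Nothing repeats, so any part will do.\<close>
  then show ?thesis using that[of 1] t_pos by (auto simp: inj_on_def)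
next
  case False
  \<comment> \<open>The clause on labels outside the part is what later allows two repeated pairs to
    be compared.\<close>
  have same: "\<exists>i\<in>{1..t}. u \<in> P i \<and> v \<in> P i \<and> (\<forall>w\<in>V - P i. f u < f w)"
    if uv: "u \<in> V" "v \<in> V" "u \<noteq> v" "f u = f v" for u v
  proof -
    obtain i where i: "i \<in> {1..t}" "u \<in> P i" using uv by (auto simp: multipartite_verts_def)
    have v: "v \<in> P i"
      using is_ranking_not_adjacent[OF r uv] edge_outside(1)[OF i, of v] uv F by auto
    have "f u < f w" if "w \<in> V - P i" for w
      using is_ranking_common_neighbour[OF r uv(1,2) _ uv(3,4), of w]
        edge_outside(1)[OF i that] edge_outside(2)[OF i(1) v that] that F by auto
    then show ?thesis using i v by blast
  qed
  obtain x y where xy: "x \<in> V" "y \<in> V" "x \<noteq> y" "f x = f y"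
    using False by (auto simp: inj_on_def)
  obtain i where i: "i \<in> {1..t}" "x \<in> P i" "\<forall>w\<in>V - P i. f x < f w"
    using same[OF xy] by blast
  show ?thesis
  proof (rule that[OF i(1)])
    fix u v assume uv: "u \<in> V" "v \<in> V" "u \<noteq> v" "f u = f v"
    obtain j where j: "j \<in> {1..t}" "u \<in> P j" "v \<in> P j" "\<forall>w\<in>V - P j. f u < f w"
      using same[OF uv] by blast
    have "i = j"
    \<comment> \<open>If the parts differed, \<open>x\<close> and \<open>u\<close> would each lie
      outside the other's part, giving both \<open>f x < f u\<close> and
      \<open>f u < f x\<close>.\<close>
    proof (rule ccontr)
      assume "i \<noteq> j"
      then have "u \<in> V - P i" "x \<in> V - P j" using i j uv xy part_unique by blast+
      then show False using i j by (metis less_asym)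
    qed
    then show "u \<in> P i \<and> v \<in> P i" using j by blast
  qed
qed

text \<open>Outside \<open>P i\<close> the labels are pairwise distinct and differ from those on
  \<open>P i\<close>, so the labels in use can be counted exactly.\<close>

lemma is_ranking_card:
  assumes r: "is_ranking V F k f" and F: "E \<subseteq> F"
  obtains i where "i \<in> {1..t}" "card V - card (P i) + card (f ` P i) \<le> k"
proof -
  obtain i where i: "i \<in> {1..t}"
    and rep: "\<And>u v. u \<in> V \<Longrightarrow> v \<in> V \<Longrightarrow> u \<noteq> v \<Longrightarrow> f u = f v \<Longrightarrow> u \<in> P i \<and> v \<in> P i"
    by (rule repeated_labels_in_one_part[OF assms]) blast
  note sub = part_subset[OF i] and fi = fin[OF i]
  have "inj_on f (V - P i)" using rep by (auto simp: inj_on_def)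
  then have "card (f ` (V - P i)) = card V - card (P i)"
    using sub fi by (simp add: card_image card_Diff_subset)
  moreover have "f ` (V - P i) \<inter> f ` P i = {}" using rep sub by fastforce
  moreover have "f ` V = f ` (V - P i) \<union> f ` P i" using sub by blast
  ultimately have "card (f ` V) = card V - card (P i) + card (f ` P i)"
    using finite_V fi by (simp add: card_Un_disjoint)
  moreover have "card (f ` V) \<le> k"
    using r card_mono[of "{1..k}" "f ` V"] by (simp add: is_ranking_def)
  ultimately show ?thesis using that i by simp
qed

text \<open>The part supplied by \<open>is_ranking_card\<close> is nonempty, so it takes at least
  one label, and it has at most \<open>card (P 1)\<close> vertices.\<close>

lemma rank_number_ge:
  assumes "E \<subseteq> F"
  shows "card V - card (P 1) + 1 \<le> rank_number V F"
proof -
  obtain f where "is_ranking V F (rank_number V F) f"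
    using ex_is_ranking[OF finite_V] rank_number_attained by metis
  then obtain i where i: "i \<in> {1..t}"
    "card V - card (P i) + card (f ` P i) \<le> rank_number V F"
    using is_ranking_card assms by metis
  moreover have "card (f ` P i) > 0" using i fin nonempty by (simp add: card_gt_0_iff)
  ultimately show ?thesis using card_le[OF i(1)] by linarith
qed

text \<open>All three claims reduce to this criterion. Forward, an optimal ranking leaves no slack
  in the label count; backward, the spared part is an independent set.\<close>

lemma rank_number_eq_iff:
  assumes H: "H \<subseteq> non_edges V E"
  shows "rank_number V (E \<union> H) = card V - card (P 1) + 1 \<longleftrightarrow>
    (\<exists>i\<in>{1..t}. card (P i) = card (P 1) \<and> H \<inter> all_edges (P i) = {})"
proof
  assume eq: "rank_number V (E \<union> H) = card V - card (P 1) + 1"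
  obtain f where f: "is_ranking V (E \<union> H) (rank_number V (E \<union> H)) f"
    using ex_is_ranking[OF finite_V] rank_number_attained by metis
  then obtain i where i: "i \<in> {1..t}"
    "card V - card (P i) + card (f ` P i) \<le> card V - card (P 1) + 1"
    using is_ranking_card[OF f] eq by auto
  have pos: "card (f ` P i) > 0" using i fin nonempty by (simp add: card_gt_0_iff)
  \<comment> \<open>Rules out truncation in \<open>card V - card (P 1)\<close>; the count then
    forces both equalities below.\<close>
  have "card (P 1) \<le> card V"
    using card_mono[OF finite_V part_subset[of 1]] t_pos by simp
  then have c: "card (P i) = card (P 1)" "card (f ` P i) = 1"
    using i pos card_le[OF i(1)] by linarith+
  have "{u, v} \<notin> H" if uv: "u \<in> P i" "v \<in> P i" "u \<noteq> v" for u v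
  proof -
    have "f u = f v" using c(2) uv by (metis card_1_singletonE imageI singletonD)
    then show ?thesis
      using is_ranking_not_adjacent[OF f, of u v] part_subset[OF i(1)] uv by blast
  qed
  then have "H \<inter> all_edges (P i) = {}" by (auto simp: all_edges_def)
  then show "\<exists>i\<in>{1..t}. card (P i) = card (P 1) \<and> H \<inter> all_edges (P i) = {}"
    using i c by blast
next
  assume "\<exists>i\<in>{1..t}. card (P i) = card (P 1) \<and> H \<inter> all_edges (P i) = {}"
  then obtain i where i: "i \<in> {1..t}" "card (P i) = card (P 1)" "H \<inter> all_edges (P i) = {}"
    by blast
  have "{u, v} \<notin> E \<union> H" if "u \<in> P i" "v \<in> P i" "u \<noteq> v" for u v
    using that i edge_iff by (auto simp: all_edges_def)
  then have "rank_number V (E \<union> H) \<le> card V - card (P i) + 1"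
    using rank_number_le_independent[OF finite_V part_subset[OF i(1)]] by blast
  then show "rank_number V (E \<union> H) = card V - card (P 1) + 1"
    using rank_number_ge[of "E \<union> H"] i by simp
qed

lemma rank_number_eq: "rank_number V E = card V - card (P 1) + 1"
  using rank_number_eq_iff[of "{}"] t_pos by auto

section \<open>Forbidden and good edges\<close>

lemma forbidden_edgeI:
  assumes uniq: "\<forall>i\<in>{2..t}. card (P i) \<noteq> card (P 1)" and e: "e \<in> all_edges (P 1)"
  shows "forbidden_edge V E e"
proof -
  have ne: "e \<in> non_edges V E" using e t_pos by (auto simp: non_edges_eq)
  \<comment> \<open>Part 1 is the only largest part and contains \<open>e\<close>, so the criterion
    has no witness.\<close>
  have "i = 1" if "i \<in> {1..t}" "card (P i) = card (P 1)" for i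
    using uniq that by (cases "i = 1") auto
  then have "rank_number V (E \<union> {e}) \<noteq> card V - card (P 1) + 1"
    using rank_number_eq_iff[of "{e}"] ne e by blast
  then show ?thesis
    using rank_number_ge[of "E \<union> {e}", OF Un_upper1] ne
    by (simp add: forbidden_edge_def rank_number_eq)
qed

text \<open>Part \<open>i\<close> is the spared part. The case \<open>j = 1\<close> is covered too,
  for when another part also has maximum order.\<close>

lemma good_edgeI:
  assumes i: "i \<in> {1..t}" "card (P i) = card (P 1)" and j: "j \<in> {1..t}" "i \<noteq> j"
    and e: "e \<in> all_edges (P j)"
  shows "good_edge V E e"
proof -
  have ne: "e \<in> non_edges V E" using e j by (auto simp: non_edges_eq)
  have "P i \<inter> P j = {}" using i j disj by (auto simp: disjoint_family_on_def)
  then have "{e} \<inter> all_edges (P i) = {}" using disjoint_all_edges e by blast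
  then have "rank_number V (E \<union> {e}) = card V - card (P 1) + 1"
    using rank_number_eq_iff[of "{e}"] ne i by blast
  then show ?thesis using ne by (simp add: good_edge_def rank_number_eq)
qed

section \<open>The value of \<open>mu\<close>\<close>

lemma card_non_edges_avoiding:
  assumes i: "i \<in> {1..t}"
  shows "card (non_edges V E - all_edges (P i)) = (\<Sum>j\<in>{1..t} - {i}. card (P j) choose 2)"
proof -
  have dj: "all_edges (P a) \<inter> all_edges (P b) = {}" if "a \<in> {1..t}" "b \<in> {1..t}" "a \<noteq> b" for a b
    using that disj by (intro disjoint_all_edges) (auto simp: disjoint_family_on_def)
  have "non_edges V E - all_edges (P i) = (\<Union>j\<in>{1..t} - {i}. all_edges (P j))"
    unfolding non_edges_eq using dj i by fastforce
  also have "card \<dots> = (\<Sum>j\<in>{1..t} - {i}. card (all_edges (P j)))"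
    using dj fin by (intro card_UN_disjoint) (auto simp: finite_all_edges)
  also have "\<dots> = (\<Sum>j\<in>{1..t} - {i}. card (P j) choose 2)"
    using fin by (intro sum.cong) (auto simp: card_all_edges)
  finally show ?thesis .
qed

text \<open>Dropping part \<open>i\<close> or part 1 from the sum over all parts removes equal
  terms, so it does not matter which largest part is spared.\<close>

lemma sum_choose_avoiding:
  assumes i: "i \<in> {1..t}" "card (P i) = card (P 1)"
  shows "(\<Sum>j\<in>{1..t} - {i}. card (P j) choose 2) = (\<Sum>j = 2..t. card (P j) choose 2)"
proof -
  have "{1..t} - {1} = {2..t}" by auto
  then show ?thesis
    using i t_pos sum_diff1_nat[of "\<lambda>j. card (P j) choose 2" "{1..t}" i]
      sum_diff1_nat[of "\<lambda>j. card (P j) choose 2" "{1..t}" 1] by simp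
qed

lemma mu_eq: "mu V E = (\<Sum>j = 2..t. card (P j) choose 2)"
proof -
  \<comment> \<open>\<open>N i\<close> is the largest set of new edges that spares part
    \<open>i\<close>.\<close>
  define N where "N i = non_edges V E - all_edges (P i)" for i
  have card_N: "card (N i) = (\<Sum>j = 2..t. card (P j) choose 2)"
    if "i \<in> {1..t}" "card (P i) = card (P 1)" for i
    using card_non_edges_avoiding sum_choose_avoiding that by (simp add: N_def)
  have fin_N: "finite (N i)" for i
    using fin by (simp add: N_def non_edges_eq finite_all_edges)
  \<comment> \<open>Turns the maximum over admissible \<open>H\<close> into one over subsets of the
    sets \<open>N i\<close> of largest parts, all of the same cardinality.\<close>
  have char: "H \<subseteq> non_edges V E \<and> rank_number V (E \<union> H) = rank_number V E \<longleftrightarrow>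
      (\<exists>i\<in>{1..t}. card (P i) = card (P 1) \<and> H \<subseteq> N i)" for H
    using rank_number_eq_iff[of H] unfolding rank_number_eq N_def by blast
  let ?S = "{card H | H. \<exists>i\<in>{1..t}. card (P i) = card (P 1) \<and> H \<subseteq> N i}"
  have bound: "y \<le> (\<Sum>j = 2..t. card (P j) choose 2)" if "y \<in> ?S" for y
  proof -
    obtain H i where "y = card H" "i \<in> {1..t}" "card (P i) = card (P 1)" "H \<subseteq> N i"
      using \<open>y \<in> ?S\<close> by blast
    then show ?thesis using card_N card_mono[OF fin_N] by metis
  qed
  \<comment> \<open>\<open>Max\<close> is characterised only on finite sets; the bound provides
    finiteness.\<close>
  then have "finite ?S" by (meson finite_nat_set_iff_bounded_le)
  moreover have "(\<Sum>j = 2..t. card (P j) choose 2) \<in> ?S"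
  proof -
    have "1 \<in> {1..t}" using t_pos by simp
    then have "card (N 1) \<in> ?S" by blast
    then show ?thesis using card_N[OF \<open>1 \<in> {1..t}\<close>] by simp
  qed
  ultimately have "Max ?S = (\<Sum>j = 2..t. card (P j) choose 2)"
    using bound by (intro Max_eqI) blast+
  then show ?thesis unfolding mu_def char .
qed

end

text \<open>The claim on forbidden edges is stated for a unique largest part: with a second part of
  maximum order, an edge inside one spares the other and is good. The claim on good edges goes by
  order, so it includes part 1 in case of such a tie.\<close>

theorem theorem4p3:
  fixes t :: nat and m :: "nat \<Rightarrow> nat" and P :: "nat \<Rightarrow> 'a set"
    and V :: "'a set" and E :: "'a set set"
  assumes t_pos: "t \<ge> 1"
    and m_pos: "\<forall>i\<in>{1..t}. m i > 0"
    and m_max: "m 1 = Max (m ` {1..t})"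
    and disj: "disjoint_family_on P {1..t}"
    and parts: "\<forall>i\<in>{1..t}. finite (P i) \<and> card (P i) = m i"
    and V_eq: "V = multipartite_verts t P"
    and E_eq: "E = multipartite_edges t P"
  shows
    "((\<forall>i\<in>{2..t}. m i \<noteq> m 1) \<longrightarrow>
        (\<forall>i\<in>{1..t}. m i = m 1 \<longrightarrow>
           (\<forall>u\<in>P i. \<forall>v\<in>P i. u \<noteq> v \<longrightarrow> forbidden_edge V E {u, v})))
     \<and> (\<forall>i\<in>{2..t}. \<forall>j\<in>{1..t}. m j = m i \<longrightarrow>
           (\<forall>u\<in>P j. \<forall>v\<in>P j. u \<noteq> v \<longrightarrow> good_edge V E {u, v}))
     \<and> real (mu V E) = (\<Sum>i = 2..t. (real (m i) - 1) * real (m i) / 2)"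
proof -
  interpret M: multipartite t P
  proof
    fix i assume i: "i \<in> {1..t}"
    show "finite (P i)" "P i \<noteq> {}" using i m_pos parts by (auto dest!: bspec[of _ _ i])
    have "m i \<le> m 1" using i unfolding m_max by simp
    then show "card (P i) \<le> card (P 1)" using i parts t_pos by simp
  qed (use t_pos disj in auto)
  have c: "card (P i) = m i" if "i \<in> {1..t}" for i using parts that by blast
  have c1: "card (P 1) = m 1" using c t_pos by simp
  have edgeI: "{u, v} \<in> all_edges (P i)" if "u \<in> P i" "v \<in> P i" "u \<noteq> v" for u v i
    using that by (auto simp: all_edges_def)
  have 1: "forbidden_edge V E {u, v}"
    if "\<forall>i\<in>{2..t}. m i \<noteq> m 1" "i \<in> {1..t}" "m i = m 1" "u \<in> P i" "v \<in> P i" "u \<noteq> v" for i u v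
  proof -
    have "i = 1" using that by (cases "i = 1") auto
    then have "{u, v} \<in> all_edges (P 1)" using edgeI that(4-6) by simp
    moreover have "\<forall>i\<in>{2..t}. card (P i) \<noteq> card (P 1)" using that(1) c c1 by simp
    ultimately show ?thesis unfolding V_eq E_eq by (intro M.forbidden_edgeI)
  qed
  have 2: "good_edge V E {u, v}"
    if "i \<in> {2..t}" "j \<in> {1..t}" "m j = m i" "u \<in> P j" "v \<in> P j" "u \<noteq> v" for i j u v
  proof -
    \<comment> \<open>A largest part other than \<open>j\<close> is needed. For \<open>j = 1\<close>
      the part \<open>i\<close> serves, since \<open>m i = m j = m 1\<close>; otherwise part 1
      does.\<close>
    obtain l where l: "l \<in> {1..t}" "m l = m 1" "l \<noteq> j"
    proof (cases "j = 1")
      case True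
      show ?thesis using that[of i] True \<open>i \<in> {2..t}\<close> \<open>m j = m i\<close> by auto
    next
      case False
      show ?thesis using that[of 1] False t_pos by auto
    qed
    then have "card (P l) = card (P 1)" using c c1 by simp
    then show ?thesis
      unfolding V_eq E_eq by (rule M.good_edgeI[OF l(1) _ that(2) l(3) edgeI[OF that(4-6)]])
  qed
  have "real (mu V E) = (\<Sum>i = 2..t. real (m i choose 2))"
    using M.mu_eq c by (simp add: V_eq E_eq)
  then have "real (mu V E) = (\<Sum>i = 2..t. (real (m i) - 1) * real (m i) / 2)"
    by (simp add: real_choose_two)
  then show ?thesis
    by (intro conjI impI ballI) (rule 1 2; assumption)+
qed

end
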